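(* Let $\mathcal{M}$ be an infinite $\mathscr{L}$-structure. If $\mathcal{M}$ is $2$-sunflowerable, then $\mathcal{M}$ is indivisible.
   Context: $\mathscr{L}$ is a first-order language all of whose function and relation symbols have finite arity. Script letters denote structures, Roman letters their underlying sets. For $B\subseteq M$, $\mathcal{M}\restriction_B$ is the substructure of $\mathcal{M}$ with underlying set $B$. A set $Y$ of finite sets is a sunflower if there is a set $r$ such that $p\cap q=r$ for all distinct $p,q\in Y$. An infinite $\mathscr{L}$-structure $\mathcal{M}$ is $2$-sunflowerable if for every $\mathscr{L}$-structure $\mathcal{Y}\cong\mathcal{M}$ all of whose elements are sets of size $2$, there is a substructure $\mathcal{Z}\subseteq\mathcal{Y}$ with $\mathcal{Z}\cong\mathcal{Y}$ whose underlying set $Z$ is a sunflower. $\mathcal{M}$ is indivisible if whenever $(P_i)_{i\in\alpha}$ is a partition of $M$ with $\alpha<|M|$, there are $i\in\alpha$ and $Q\subseteq P_i$ with $\mathcal{M}\restriction_Q\cong\mathcal{M}$. *)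

theory Defs
  imports "HOL-Library.Disjoint_Sets"
begin

text \<open>
  First-order languages with finitary function and relation symbols. The symbols form subsets of
  the symbol types, so that a language may lack function symbols (or relation symbols) altogether.
  Constants are function symbols of arity 0.
\<close>

record ('f, 'r) language =
  fsyms :: "'f set"
  rsyms :: "'r set"
  farity :: "'f \<Rightarrow> nat"
  rarity :: "'r \<Rightarrow> nat"

record ('f, 'r, 'a) fo_struct =
  universe :: "'a set"
  finterp :: "'f \<Rightarrow> 'a list \<Rightarrow> 'a"
  rinterp :: "'r \<Rightarrow> 'a list \<Rightarrow> bool"

text \<open>
  Only the values of interpretations on tuples of the right length with entries in the universe
  matter; all notions below ignore the other values.
\<close>

definition is_structure :: "('f, 'r) language \<Rightarrow> ('f, 'r, 'a) fo_struct \<Rightarrow> bool" where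
  "is_structure L M \<longleftrightarrow>
     (\<forall>f\<in>fsyms L. \<forall>xs. length xs = farity L f \<and> set xs \<subseteq> universe M
        \<longrightarrow> finterp M f xs \<in> universe M)"

definition is_isomorphism ::
  "('f, 'r) language \<Rightarrow> ('f, 'r, 'a) fo_struct \<Rightarrow> ('f, 'r, 'b) fo_struct \<Rightarrow> ('a \<Rightarrow> 'b) \<Rightarrow> bool" where
  "is_isomorphism L M N h \<longleftrightarrow>
     bij_betw h (universe M) (universe N) \<and>
     (\<forall>f\<in>fsyms L. \<forall>xs. length xs = farity L f \<and> set xs \<subseteq> universe M
        \<longrightarrow> h (finterp M f xs) = finterp N f (map h xs)) \<and>
     (\<forall>R\<in>rsyms L. \<forall>xs. length xs = rarity L R \<and> set xs \<subseteq> universe M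
        \<longrightarrow> (rinterp M R xs \<longleftrightarrow> rinterp N R (map h xs)))"

definition isomorphic ::
  "('f, 'r) language \<Rightarrow> ('f, 'r, 'a) fo_struct \<Rightarrow> ('f, 'r, 'b) fo_struct \<Rightarrow> bool" where
  "isomorphic L M N \<longleftrightarrow>
     is_structure L M \<and> is_structure L N \<and> (\<exists>h. is_isomorphism L M N h)"

definition substructure ::
  "('f, 'r) language \<Rightarrow> ('f, 'r, 'a) fo_struct \<Rightarrow> ('f, 'r, 'a) fo_struct \<Rightarrow> bool" where
  "substructure L N M \<longleftrightarrow>
     is_structure L N \<and> is_structure L M \<and> universe N \<subseteq> universe M \<and>
     (\<forall>f\<in>fsyms L. \<forall>xs. length xs = farity L f \<and> set xs \<subseteq> universe N
        \<longrightarrow> finterp N f xs = finterp M f xs) \<and>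
     (\<forall>R\<in>rsyms L. \<forall>xs. length xs = rarity L R \<and> set xs \<subseteq> universe N
        \<longrightarrow> (rinterp N R xs \<longleftrightarrow> rinterp M R xs))"

text \<open>
  For \<open>B \<subseteq> universe M\<close>, \<open>restrict_struct M B\<close> is a structure (and then the substructure of \<open>M\<close>
  with underlying set \<open>B\<close>) iff \<open>B\<close> is closed under the functions of \<open>M\<close>. Since \<open>isomorphic\<close>
  demands that both sides be structures, \<open>isomorphic L (restrict_struct M B) M\<close> includes this
  closure condition.
\<close>

definition restrict_struct :: "('f, 'r, 'a) fo_struct \<Rightarrow> 'a set \<Rightarrow> ('f, 'r, 'a) fo_struct" where
  "restrict_struct M B = M\<lparr>universe := B\<rparr>"

definition sunflower :: "'a set set \<Rightarrow> bool" where
  "sunflower Y \<longleftrightarrow>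
     (\<forall>p\<in>Y. finite p) \<and> (\<exists>r. \<forall>p\<in>Y. \<forall>q\<in>Y. p \<noteq> q \<longrightarrow> p \<inter> q = r)"

text \<open>
  HOL cannot quantify over all types of potential elements of the two-element sets, so these are
  taken to be subsets of the type \<open>'a\<close> over which \<open>M\<close> lives. For infinite \<open>M\<close> this is
  no restriction: see \<open>two_sunflowerable_any_type\<close> below.
\<close>

definition two_sunflowerable :: "('f, 'r) language \<Rightarrow> ('f, 'r, 'a) fo_struct \<Rightarrow> bool" where
  "two_sunflowerable L M \<longleftrightarrow>
     (\<forall>Y :: ('f, 'r, 'a set) fo_struct.
        is_structure L Y \<and> isomorphic L Y M \<and> (\<forall>p\<in>universe Y. card p = 2) \<longrightarrow>
        (\<exists>Z. substructure L Z Y \<and> isomorphic L Z Y \<and> sunflower (universe Z)))"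

text \<open>
  A partition is rendered by its set of (nonempty) parts; \<open>indivisible_family\<close> below gives the
  version for indexed families, in which empty parts and arbitrary index types are allowed.
\<close>

definition indivisible :: "('f, 'r) language \<Rightarrow> ('f, 'r, 'a) fo_struct \<Rightarrow> bool" where
  "indivisible L M \<longleftrightarrow>
     (\<forall>P. partition_on (universe M) P \<and> (card_of P, card_of (universe M)) \<in> ordLess \<longrightarrow>
        (\<exists>p\<in>P. \<exists>Q\<subseteq>p. isomorphic L (restrict_struct M Q) M))"

lemma is_isomorphism_inv:
  assumes M: "is_structure L M" and h: "is_isomorphism L M N h"
  shows "is_isomorphism L N M (inv_into (universe M) h)"
proof -
  let ?d = "inv_into (universe M) h"
  have b: "bij_betw h (universe M) (universe N)"
    using h by (simp add: is_isomorphism_def)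
  have bd: "bij_betw ?d (universe N) (universe M)"
    using b by (rule bij_betw_inv_into)
  have sub: "set (map ?d xs) \<subseteq> universe M" if "set xs \<subseteq> universe N" for xs
    using that bd by (auto simp: bij_betw_def)
  have hdx: "map h (map ?d xs) = xs" if "set xs \<subseteq> universe N" for xs
    unfolding map_map using that b
    by (intro map_idI) (auto simp: bij_betw_inv_into_right)
  have hf: "h (finterp M f (map ?d xs)) = finterp N f xs"
    if "f \<in> fsyms L" "length xs = farity L f" "set xs \<subseteq> universe N" for f xs
    using h that sub[OF that(3)] hdx[OF that(3)] unfolding is_isomorphism_def
    by (metis length_map)
  have hr: "rinterp M R (map ?d xs) = rinterp N R xs"
    if "R \<in> rsyms L" "length xs = rarity L R" "set xs \<subseteq> universe N" for R xs
    using h that sub[OF that(3)] hdx[OF that(3)] unfolding is_isomorphism_def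
    by (metis length_map)
  have "?d (finterp N f xs) = finterp M f (map ?d xs)"
    if "f \<in> fsyms L" "length xs = farity L f" "set xs \<subseteq> universe N" for f xs
  proof -
    have "finterp M f (map ?d xs) \<in> universe M"
      using M that sub[OF that(3)] unfolding is_structure_def by (metis length_map)
    then show ?thesis
      using hf[OF that] b by (metis bij_betw_inv_into_left)
  qed
  then show ?thesis
    using bd hr by (auto simp: is_isomorphism_def)
qed

lemma isomorphic_sym: "isomorphic L M N \<Longrightarrow> isomorphic L N M"
  unfolding isomorphic_def using is_isomorphism_inv by blast

lemma is_isomorphism_comp:
  assumes g: "is_isomorphism L M N g" and h: "is_isomorphism L N K h"
    and M: "is_structure L M"
  shows "is_isomorphism L M K (h \<circ> g)"
proof -
  have b: "bij_betw g (universe M) (universe N)"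
    using g by (simp add: is_isomorphism_def)
  have sub: "set (map g xs) \<subseteq> universe N" if "set xs \<subseteq> universe M" for xs
    using that b by (auto simp: bij_betw_def)
  have "(h \<circ> g) (finterp M f xs) = finterp K f (map (h \<circ> g) xs)"
    if "f \<in> fsyms L" "length xs = farity L f" "set xs \<subseteq> universe M" for f xs
  proof -
    have "g (finterp M f xs) = finterp N f (map g xs)"
      using g that by (simp add: is_isomorphism_def)
    moreover have "h (finterp N f (map g xs)) = finterp K f (map h (map g xs))"
      using h that sub[OF that(3)] unfolding is_isomorphism_def by (metis length_map)
    ultimately show ?thesis by simp
  qed
  moreover have "rinterp M R xs = rinterp K R (map (h \<circ> g) xs)"
    if "R \<in> rsyms L" "length xs = rarity L R" "set xs \<subseteq> universe M" for R xs
  proof -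
    have "rinterp M R xs = rinterp N R (map g xs)"
      using g that by (simp add: is_isomorphism_def)
    moreover have "rinterp N R (map g xs) = rinterp K R (map h (map g xs))"
      using h that sub[OF that(3)] unfolding is_isomorphism_def by (metis length_map)
    ultimately show ?thesis by simp
  qed
  moreover have "bij_betw (h \<circ> g) (universe M) (universe K)"
    using g h by (auto simp: is_isomorphism_def intro: bij_betw_trans)
  ultimately show ?thesis by (auto simp: is_isomorphism_def)
qed

lemma isomorphic_trans: "isomorphic L M N \<Longrightarrow> isomorphic L N K \<Longrightarrow> isomorphic L M K"
  unfolding isomorphic_def using is_isomorphism_comp by blast

lemma isomorphic_substructure:
  assumes h: "is_isomorphism L Y X h" and Y: "is_structure L Y"
    and ZY: "substructure L Z Y"
  obtains W where "substructure L W X" "isomorphic L W Z" "universe W = h ` universe Z"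
proof -
  define W where "W = X\<lparr>universe := h ` universe Z\<rparr>"
  have b: "bij_betw h (universe Y) (universe X)"
    using h by (simp add: is_isomorphism_def)
  have Zs: "universe Z \<subseteq> universe Y"
    using ZY by (simp add: substructure_def)
  have Zst: "is_structure L Z"
    using ZY by (simp add: substructure_def)
  have fn: "h (finterp Z f xs) = finterp X f (map h xs)"
    if "f \<in> fsyms L" "length xs = farity L f" "set xs \<subseteq> universe Z" for f xs
  proof -
    have "finterp Z f xs = finterp Y f xs"
      using ZY that by (simp add: substructure_def)
    moreover have "set xs \<subseteq> universe Y" using that Zs by blast
    ultimately show ?thesis using h that by (simp add: is_isomorphism_def)
  qed
  have rl: "rinterp Z R xs = rinterp X R (map h xs)"
    if "R \<in> rsyms L" "length xs = rarity L R" "set xs \<subseteq> universe Z" for R xs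
  proof -
    have "rinterp Z R xs = rinterp Y R xs"
      using ZY that by (simp add: substructure_def)
    moreover have "set xs \<subseteq> universe Y" using that Zs by blast
    ultimately show ?thesis using h that by (simp add: is_isomorphism_def)
  qed
  have lift: "\<exists>ys. xs = map h ys \<and> set ys \<subseteq> universe Z" if "set xs \<subseteq> h ` universe Z" for xs
    using that
  proof (induction xs)
    case Nil
    then show ?case by simp
  next
    case (Cons x xs)
    then obtain ys where ys: "xs = map h ys" "set ys \<subseteq> universe Z" by auto
    from Cons.prems obtain y where "x = h y" "y \<in> universe Z" by auto
    with ys show ?case by (intro exI[of _ "y # ys"]) simp
  qed
  have Wst: "is_structure L W"
    unfolding is_structure_def
  proof (intro ballI allI impI)
    fix f xs
    assume f: "f \<in> fsyms L" and "length xs = farity L f \<and> set xs \<subseteq> universe W"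
    then obtain ys where ys: "xs = map h ys" "set ys \<subseteq> universe Z" "length ys = farity L f"
      using lift[of xs] by (auto simp: W_def)
    have "finterp Z f ys \<in> universe Z"
      using Zst f ys by (simp add: is_structure_def)
    then have "h (finterp Z f ys) \<in> universe W" by (simp add: W_def)
    then show "finterp W f xs \<in> universe W"
      using fn[OF f ys(3,2)] ys(1) by (simp add: W_def)
  qed
  have Xst: "is_structure L X"
    unfolding is_structure_def
  proof (intro ballI allI impI)
    fix f xs
    assume f: "f \<in> fsyms L" and xs: "length xs = farity L f \<and> set xs \<subseteq> universe X"
    define ys where "ys = map (inv_into (universe Y) h) xs"
    have "map (h \<circ> inv_into (universe Y) h) xs = xs"
      using xs b by (intro map_idI) (auto simp: bij_betw_inv_into_right)
    moreover have "inv_into (universe Y) h x \<in> universe Y" if "x \<in> universe X" for x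
      using bij_betw_inv_into[OF b] that by (rule bij_betw_apply)
    ultimately have ys: "xs = map h ys" "set ys \<subseteq> universe Y" "length ys = farity L f"
      using xs by (auto simp: ys_def)
    have "finterp Y f ys \<in> universe Y"
      using Y f ys by (simp add: is_structure_def)
    then have "h (finterp Y f ys) \<in> universe X" using b by (auto simp: bij_betw_def)
    then show "finterp X f xs \<in> universe X"
      using h f ys by (simp add: is_isomorphism_def)
  qed
  have "is_isomorphism L Z W h"
    using fn rl bij_betw_subset[OF b Zs refl] by (simp add: is_isomorphism_def W_def)
  then have "isomorphic L Z W"
    using Zst Wst by (auto simp: isomorphic_def)
  moreover have "substructure L W X"
    using Wst Xst Zs b by (auto simp: substructure_def W_def bij_betw_def)
  moreover have "universe W = h ` universe Z" by (simp add: W_def)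
  ultimately show ?thesis using that isomorphic_sym by blast
qed

theorem two_sunflowerable_any_type:
  fixes M :: "('f, 'r, 'a) fo_struct" and Y :: "('f, 'r, 'b set) fo_struct"
  assumes inf: "infinite (universe M)" and sun: "two_sunflowerable L M"
    and iso: "isomorphic L Y M" and two: "\<forall>p\<in>universe Y. card p = 2"
  shows "\<exists>Z. substructure L Z Y \<and> isomorphic L Z Y \<and> sunflower (universe Z)"
proof -
  define U where "U = \<Union> (universe Y)"
  obtain k where k: "bij_betw k (universe Y) (universe M)"
    using iso by (auto simp: isomorphic_def is_isomorphism_def)
  have fin: "finite p" if "p \<in> universe Y" for p
    using two that by (metis card.infinite zero_neq_numeral)
  have infY: "infinite (universe Y)"
    using k inf by (simp add: bij_betw_finite)
  have "(card_of (\<Union>p\<in>universe Y. p), card_of (universe Y)) \<in> ordLeq"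
  proof (rule card_of_UNION_ordLeq_infinite[OF infY])
    show "ordLeq3 (card_of (universe Y)) (card_of (universe Y))"
      by (simp add: card_of_refl ordIso_imp_ordLeq)
    show "\<forall>p\<in>universe Y. ordLeq3 (card_of p) (card_of (universe Y))"
      using fin infY
      by (metis card_of_Well_order card_of_ordLeq_finite ordLeq_total)
  qed
  then obtain g0 where g0: "inj_on g0 U" "g0 ` U \<subseteq> universe Y"
    unfolding U_def by (auto simp: card_of_ordLeq[symmetric])
  define g where "g = k \<circ> g0"
  have g: "inj_on g U"
    unfolding g_def using g0 k by (meson bij_betw_def comp_inj_on inj_on_subset)
  define e where "e = image g"
  have sub: "p \<subseteq> U" if "p \<in> universe Y" for p
    using that by (auto simp: U_def)
  have e: "inj_on e (universe Y)"
    unfolding e_def using inj_on_image_eq_iff[OF g] sub by (auto intro!: inj_onI)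
  define d where "d = inv_into (universe Y) e"
  define X :: "('f, 'r, 'a set) fo_struct" where
    "X = \<lparr>universe = e ` universe Y,
          finterp = (\<lambda>f xs. e (finterp Y f (map d xs))),
          rinterp = (\<lambda>R xs. rinterp Y R (map d xs))\<rparr>"
  have de: "d (e p) = p" if "p \<in> universe Y" for p
    unfolding d_def using e that by simp
  have dem: "map (d \<circ> e) xs = xs" if "set xs \<subseteq> universe Y" for xs
    using that de by (auto intro!: map_idI)
  have Yst: "is_structure L Y"
    using iso by (simp add: isomorphic_def)
  have YX: "is_isomorphism L Y X e"
    using e dem by (auto simp: is_isomorphism_def X_def bij_betw_def)
  have "substructure L Y Y" using Yst by (simp add: substructure_def)
  then obtain W where "substructure L W X"
    using isomorphic_substructure[OF YX Yst] by blast
  then have Xst: "is_structure L X" by (simp add: substructure_def)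
  have isoYX: "isomorphic L Y X"
    using YX Yst Xst by (auto simp: isomorphic_def)
  have "isomorphic L X M"
    using isomorphic_trans[OF isomorphic_sym[OF isoYX] iso] .
  moreover have "card p = 2" if "p \<in> universe X" for p
  proof -
    from that obtain q where q: "q \<in> universe Y" "p = g ` q"
      by (auto simp: X_def e_def)
    then show ?thesis
      using two sub[OF q(1)] card_image[OF inj_on_subset[OF g]] by simp
  qed
  ultimately obtain Z where Z: "substructure L Z X" "isomorphic L Z X" "sunflower (universe Z)"
    using sun Xst unfolding two_sunflowerable_def by blast
  have XY: "is_isomorphism L X Y d"
    unfolding d_def using is_isomorphism_inv[OF Yst YX] .
  obtain V where V: "substructure L V Y" "isomorphic L V Z" "universe V = d ` universe Z"
    using isomorphic_substructure[OF XY Xst Z(1)] by blast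
  have VY: "universe V \<subseteq> universe Y" using V(1) by (simp add: substructure_def)
  have ZX: "universe Z \<subseteq> universe X" using Z(1) by (simp add: substructure_def)
  have eV: "e p \<in> universe Z" if "p \<in> universe V" for p
    using that V(3) ZX de by (auto simp: X_def)
  from Z(3) obtain r where r: "\<forall>p\<in>universe Z. \<forall>q\<in>universe Z. p \<noteq> q \<longrightarrow> p \<inter> q = r"
    unfolding sunflower_def by auto
  have "p \<inter> q = {x \<in> U. g x \<in> r}" if pq: "p \<in> universe V" "q \<in> universe V" "p \<noteq> q" for p q
  proof -
    have "e p \<noteq> e q" using pq VY inj_on_eq_iff[OF e] by (metis subsetD)
    then have "e p \<inter> e q = r" using r eV[OF pq(1)] eV[OF pq(2)] by simp
    moreover have U: "p \<subseteq> U" "q \<subseteq> U"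
      using VY sub pq(1,2) by auto
    ultimately have r': "g ` (p \<inter> q) = r"
      using inj_on_image_Int[OF g U] unfolding e_def by simp
    have "x \<in> p \<inter> q \<longleftrightarrow> g x \<in> r" if "x \<in> U" for x
      using inj_on_image_mem_iff[OF g that, of "p \<inter> q"] U(1) r' by (simp add: le_infI1)
    then show ?thesis using U by blast
  qed
  then have "sunflower (universe V)"
    unfolding sunflower_def
    using fin VY by (intro conjI exI[of _ "{x \<in> U. g x \<in> r}"]) auto
  moreover have "isomorphic L V Y"
    using isomorphic_trans[OF V(2) isomorphic_trans[OF Z(2) isomorphic_sym[OF isoYX]]] .
  ultimately show ?thesis using V(1) by blast
qed

theorem indivisible_family:
  fixes M :: "('f, 'r, 'a) fo_struct" and I :: "'i set" and P :: "'i \<Rightarrow> 'a set"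
  assumes ind: "indivisible L M"
    and disj: "disjoint_family_on P I" and un: "(\<Union>i\<in>I. P i) = universe M"
    and less: "(card_of I, card_of (universe M)) \<in> ordLess"
  shows "\<exists>i\<in>I. \<exists>Q\<subseteq>P i. isomorphic L (restrict_struct M Q) M"
proof -
  have "partition_on (universe M) (P ` I - {{}})"
    using un disj by (fastforce simp: partition_on_def disjoint_def disjoint_family_on_def)
  moreover have "(card_of (P ` I - {{}}), card_of I) \<in> ordLeq"
    by (meson Diff_subset card_of_image card_of_mono1 ordLeq_transitive)
  then have "(card_of (P ` I - {{}}), card_of (universe M)) \<in> ordLess"
    using less by (rule ordLeq_ordLess_trans)
  ultimately show ?thesis
    using ind unfolding indivisible_def by blast
qed

end

(* Replace each m in M by the pair {p, m}, where p is the part of the partition containing m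
   (tagged, so that parts and elements of M cannot coincide), and take an isomorphic sunflower
   among these pairs. If two of its pairs share their part p, then p lies in the kernel, so all
   of its pairs have the part p and the sunflower is a copy of M inside p. Otherwise its pairs
   have pairwise different parts, so there are at least |M| parts. *)

theory Submission
  imports Defs
begin

text \<open>Transport of structure along an injection: symbols are interpreted by pulling arguments
  back with the inverse \<open>d\<close>. This supplies the copy of \<open>M\<close> on two-element
  sets to which sunflowerability is applied.\<close>

lemma isomorphic_image_struct:
  assumes M: "is_structure L M" and h: "inj_on h (universe M)"
  obtains Y where "universe Y = h ` universe M" "is_structure L Y" "is_isomorphism L M Y h"
proof -
  define d where "d = inv_into (universe M) h"
  define Y where "Y = \<lparr>universe = h ` universe M,
    finterp = (\<lambda>f xs. h (finterp M f (map d xs))),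
    rinterp = (\<lambda>R xs. rinterp M R (map d xs))\<rparr>"
  have dh: "map (d \<circ> h) xs = xs" if "set xs \<subseteq> universe M" for xs
    using that h by (auto simp: d_def intro!: map_idI)
  have iso: "is_isomorphism L M Y h"
    using h dh by (auto simp: is_isomorphism_def Y_def bij_betw_def)
  have d: "set (map d xs) \<subseteq> universe M" if "set xs \<subseteq> h ` universe M" for xs
    using that by (auto simp: d_def intro: inv_into_into)
  have "is_structure L Y"
    unfolding is_structure_def
  proof (intro ballI allI impI)
    fix f xs
    assume "f \<in> fsyms L" "length xs = farity L f \<and> set xs \<subseteq> universe Y"
    then have "finterp M f (map d xs) \<in> universe M"
      using M d[of xs] unfolding is_structure_def by (simp add: Y_def)
    then show "finterp Y f xs \<in> universe Y"
      by (simp add: Y_def)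
  qed
  with iso show thesis
    by (intro that[of Y]) (simp_all add: Y_def)
qed

text \<open>\<open>substructure\<close> fixes \<open>V\<close> only on symbols of \<open>L\<close>
  and tuples from \<open>universe V\<close>, so the two records may differ elsewhere; the identity
  map is an isomorphism all the same.\<close>

lemma isomorphic_restrict_struct:
  assumes "substructure L V M"
  shows "isomorphic L (restrict_struct M (universe V)) V"
proof -
  have "is_isomorphism L (restrict_struct M (universe V)) V id"
    using assms by (simp add: substructure_def is_isomorphism_def restrict_struct_def)
  moreover have "is_structure L (restrict_struct M (universe V))"
    using assms unfolding substructure_def is_structure_def restrict_struct_def
    by simp metis
  ultimately show ?thesis
    using assms by (auto simp: isomorphic_def substructure_def)
qed

text \<open>If \<open>t\<close> agrees at two distinct points, the tagged value lies in the kernel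
  and hence in every pair, and each pair has just one \<open>Inl\<close> element.\<close>

lemma sunflower_tagged_pairs:
  assumes "sunflower ((\<lambda>m. {Inl (t m), Inr m}) ` V)"
  shows "(\<exists>c. \<forall>m\<in>V. t m = c) \<or> inj_on t V"
proof (rule disjCI)
  assume "\<not> inj_on t V"
  then obtain a b where ab: "a \<in> V" "b \<in> V" "a \<noteq> b" "t a = t b"
    by (auto simp: inj_on_def)
  let ?h = "\<lambda>m. {Inl (t m), Inr m}"
  \<comment> \<open>The \<open>Inr\<close> entries separate the pairs, so the kernel equation for
    distinct sets becomes one for distinct points.\<close>
  have neq: "?h m \<noteq> ?h n" if "m \<noteq> n" for m n
    using that by auto
  obtain r where r: "?h m \<inter> ?h n = r" if "m \<in> V" "n \<in> V" "m \<noteq> n" for m n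
    using assms neq unfolding sunflower_def by (metis (no_types, lifting) image_eqI)
  have "Inl (t a) \<in> r"
    using r[OF ab(1-3)] ab(4) by auto
  then have "t m = t a" if "m \<in> V" for m
    using r[OF that ab(1)] by (cases "m = a") auto
  then show "\<exists>c. \<forall>m\<in>V. t m = c" by blast
qed

theorem proposition2p7:
  fixes L :: "('f, 'r) language" and M :: "('f, 'r, 'a) fo_struct"
  assumes "is_structure L M" and "infinite (universe M)"
    and "two_sunflowerable L M"
  shows "indivisible L M"
  unfolding indivisible_def
proof (intro allI impI, elim conjE)
  fix P
  assume P: "partition_on (universe M) P"
    and less: "(card_of P, card_of (universe M)) \<in> ordLess"
  have "\<forall>m\<in>universe M. \<exists>p\<in>P. m \<in> p"
    using P by (auto simp: partition_on_def)
  then obtain t where t: "t m \<in> P" "m \<in> t m" if "m \<in> universe M" for m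
    by metis
  define h :: "'a \<Rightarrow> ('a set + 'a) set" where "h = (\<lambda>m. {Inl (t m), Inr m})"
  have h: "inj_on h (universe M)"
    by (auto simp: h_def inj_on_def)
  obtain Y where Y: "universe Y = h ` universe M" "is_structure L Y" "is_isomorphism L M Y h"
    using isomorphic_image_struct[OF assms(1) h] .
  have YM: "isomorphic L Y M"
    using assms(1) Y by (intro isomorphic_sym[of L M Y]) (auto simp: isomorphic_def)
  have "\<forall>p\<in>universe Y. card p = 2"
    by (auto simp: Y h_def)
  \<comment> \<open>The pairs are sets over \<open>'a set + 'a\<close> rather than
    \<open>'a\<close>, hence the version for arbitrary element types.\<close>
  then obtain Z where Z: "substructure L Z Y" "isomorphic L Z Y" "sunflower (universe Z)"
    using two_sunflowerable_any_type[OF assms(2,3) YM] by blast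
  define d where "d = inv_into (universe M) h"
  have "is_isomorphism L Y M d"
    unfolding d_def using is_isomorphism_inv[OF assms(1) Y(3)] .
  \<comment> \<open>Pulling \<open>Z\<close> back along \<open>d\<close> yields a substructure of
    \<open>M\<close> whose tagged pairs are exactly the elements of \<open>Z\<close>.\<close>
  then obtain V where V: "substructure L V M" "isomorphic L V Z" "universe V = d ` universe Z"
    using isomorphic_substructure Y(2) Z(1) by blast
  have VM: "isomorphic L V M"
    using isomorphic_trans[OF V(2) isomorphic_trans[OF Z(2) YM]] .
  have sub: "universe V \<subseteq> universe M"
    using V(1) by (simp add: substructure_def)
  have "universe Z \<subseteq> h ` universe M"
    using Z(1) Y(1) by (simp add: substructure_def)
  then have "h ` universe V = universe Z"
    unfolding V(3) d_def by (rule image_inv_into_cancel[OF refl])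
  then have "(\<exists>c. \<forall>m\<in>universe V. t m = c) \<or> inj_on t (universe V)"
    using Z(3) by (intro sunflower_tagged_pairs) (simp add: h_def)
  moreover have "\<not> inj_on t (universe V)"
  proof
    \<comment> \<open>An injective \<open>t\<close> would give |M| = |V| \<le> |P|, against
      \<open>less\<close>.\<close>
    assume "inj_on t (universe V)"
    then have "(card_of (universe V), card_of P) \<in> ordLeq"
      using t sub by (intro card_of_ordLeqI) auto
    moreover obtain g where "bij_betw g (universe V) (universe M)"
      using VM by (auto simp: isomorphic_def is_isomorphism_def)
    then have "(card_of (universe M), card_of (universe V)) \<in> ordLeq"
      by (metis bij_betw_imp_surj_on card_of_image)
    ultimately have "(card_of (universe M), card_of P) \<in> ordLeq"
      using ordLeq_transitive by blast
    then show False
      using less not_ordLess_ordLeq by blast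
  qed
  ultimately obtain c where c: "t m = c" if "m \<in> universe V" for m
    by blast
  \<comment> \<open>A point \<open>m\<close> of \<open>V\<close> is what makes \<open>c\<close> =
    \<open>t m\<close> an actual part.\<close>
  have "universe V \<noteq> {}"
    using VM assms(2) by (auto simp: isomorphic_def is_isomorphism_def bij_betw_def)
  then have "c \<in> P" "universe V \<subseteq> c"
    using t c sub by blast+
  moreover have "isomorphic L (restrict_struct M (universe V)) M"
    using isomorphic_trans[OF isomorphic_restrict_struct[OF V(1)] VM] .
  ultimately show "\<exists>p\<in>P. \<exists>Q\<subseteq>p. isomorphic L (restrict_struct M Q) M"
    by blast
qed

end
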